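(* Let $p\ge n\ge 1$, let $\mathcal{I}\subset\{1,\dots,n\}\times\{1,\dots,p\}$ with complement $\bar{\mathcal{I}}$, let real numbers $\sigma_{ij}$, $(i,j)\in\bar{\mathcal{I}}$, be given, and let $\Sigma(x)\in\mathbb{R}^{n\times p}$, $x=(x_{ij})_{(i,j)\in\mathcal{I}}\in\mathbb{R}^{k}$, $k=|\mathcal{I}|$, be the associated partial matrix. Let $\bar{x}\in\mathbb{R}^k$. Then the following are equivalent: (1) $\Sigma(\bar{x})$ has full row rank and its Moore–Penrose pseudo-inverse $\Sigma(\bar{x})^{\sharp}\in\mathbb{R}^{p\times n}$ satisfies $[\Sigma(\bar{x})^{\sharp}]_{i,j}=0$ for all $(i,j)\in\mathcal{I}^{\top}$; (2) $\Sigma(\bar{x})$ has full row rank and extremizes $\det\left[\left(\Sigma(x)\Sigma(x)^{\top}\right)^{1/2}\right]$ among completions, i.e. $\bar{x}$ is a critical point of the function $x\mapsto\det\left[\left(\Sigma(x)\Sigma(x)^{\top}\right)^{1/2}\right]$.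
   Context: The partial matrix $\Sigma(x)$ is the parametric family of real $n\times p$ matrices with entries $[\Sigma(x)]_{i,j}=\sigma_{ij}$ (specified) for $(i,j)\in\bar{\mathcal{I}}$ and $[\Sigma(x)]_{i,j}=x_{ij}$ (free real unknowns) for $(i,j)\in\mathcal{I}$; $x\in\mathbb{R}^k$ is the vector obtained by stacking the unknowns. A completion is a matrix $\Sigma(\bar{x})$ with $\bar{x}\in\mathbb{R}^k$. $\mathcal{I}^{\top}:=\{(j,i):(i,j)\in\mathcal{I}\}$. For a matrix $\Sigma$ of full row rank, $\Sigma^{\sharp}=\Sigma^{\top}(\Sigma\Sigma^{\top})^{-1}$. $(\cdot)^{1/2}$ denotes the symmetric positive semidefinite square root. "Extremize" means being a critical (stationary) point: all partial derivatives with respect to the unknowns $x_{ij}$, $(i,j)\in\mathcal{I}$, vanish at $\bar{x}$ (the function is differentiable near any $\bar{x}$ for which $\Sigma(\bar{x})$ has full row rank). *)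

theory Defs
  imports "HOL-Analysis.Analysis"
begin

text \<open>
  A vector of unknowns indexed by a set \<open>I\<close> of positions is a function on all positions of which
  only the values on \<open>I\<close> are read; likewise the specified entries are read only off \<open>I\<close>.
  Thus no separate enumeration of \<open>I\<close> is needed, and \<open>I\<close> may be empty.
\<close>

definition partial_matrix ::
  "('n \<times> 'p) set \<Rightarrow> ('n \<times> 'p \<Rightarrow> real) \<Rightarrow> ('n \<times> 'p \<Rightarrow> real) \<Rightarrow> real ^ 'p::finite ^ 'n::finite"
  where "partial_matrix I \<sigma> x = (\<chi> i j. if (i, j) \<in> I then x (i, j) else \<sigma> (i, j))"

definition full_row_rank :: "real ^ 'p::finite ^ 'n::finite \<Rightarrow> bool"
  where "full_row_rank A \<longleftrightarrow> rank A = CARD('n)"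

text \<open>The Moore--Penrose pseudo-inverse, by the formula valid for matrices of full row rank only.\<close>

definition pseudo_inverse :: "real ^ 'p::finite ^ 'n::finite \<Rightarrow> real ^ 'n ^ 'p"
  where "pseudo_inverse A = transpose A ** matrix_inv (A ** transpose A)"

definition sym_psd :: "real ^ 'n::finite ^ 'n \<Rightarrow> bool"
  where "sym_psd A \<longleftrightarrow> transpose A = A \<and> (\<forall>v. 0 \<le> v \<bullet> (A *v v))"

definition psd_sqrt :: "real ^ 'n::finite ^ 'n \<Rightarrow> real ^ 'n ^ 'n"
  where "psd_sqrt A = (THE B. sym_psd B \<and> B ** B = A)"

definition critical_point :: "'a set \<Rightarrow> (('a \<Rightarrow> real) \<Rightarrow> real) \<Rightarrow> ('a \<Rightarrow> real) \<Rightarrow> bool"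
  where "critical_point I f x \<longleftrightarrow>
    (\<forall>a\<in>I. ((\<lambda>t. f (x(a := t))) has_real_derivative 0) (at (x a)))"

end

theory Submission
  imports Defs
begin

text \<open>
  Write \<open>S\<close> for a completion and \<open>G = S S\<^sup>T\<close> for its Gram matrix. The positive semidefinite root of
  \<open>G\<close> has determinant \<open>sqrt (det G)\<close>, so the objective only depends on \<open>det G\<close>, a polynomial in the
  unknowns. Where \<open>S\<close> has full row rank, \<open>det G\<close> is positive and Jacobi's formula gives the
  derivative in direction \<open>dS\<close> as \<open>det G * trace (G\<^sup>-\<^sup>1 (dS S\<^sup>T + S dS\<^sup>T))\<close>. The two summands are transposes
  of each other up to cyclic permutation, so this is \<open>2 det G * trace (dS S\<^sup>T G\<^sup>-\<^sup>1)\<close>, and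
  \<open>S\<^sup>T G\<^sup>-\<^sup>1\<close> is the pseudo-inverse. With \<open>dS\<close> the matrix unit at \<open>(i, j)\<close> the trace picks out the
  \<open>(j, i)\<close> entry of the pseudo-inverse. Hence the partial derivative of the objective with respect
  to \<open>x\<^sub>i\<^sub>j\<close> is \<open>sqrt (det G)\<close> times that entry, and the two vanish together.

  The derivative is computed in \<open>has_real_derivative_det_gram_entry\<close>. The statement about the
  root, \<open>det_psd_sqrt\<close>, needs its existence and uniqueness, since it is given by a definite
  description; both come from the spectral theorem \<open>symmetric_orthonormal_eigenbasis\<close>.
\<close>

section \<open>Symmetric matrices have an orthonormal eigenbasis\<close>

lemma symmetric_inner_mult:
  fixes A :: "real ^ 'n::finite ^ 'n"
  assumes "transpose A = A"
  shows "x \<bullet> (A *v y) = (A *v x) \<bullet> y"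
  by (metis assms dot_lmul_matrix transpose_matrix_vector)

text \<open>
  The eigenvector is a maximiser \<open>u\<close> of the Rayleigh quotient on the unit sphere of \<open>V\<close>, with
  maximum \<open>l\<close>. The quadratic form \<open>l (v \<bullet> v) - v \<bullet> A v\<close> is nonnegative on \<open>V\<close> and vanishes at
  \<open>u\<close>; moving from \<open>u\<close> along the residual \<open>w = A u - l u\<close> changes it to first order by
  \<open>- 2 t (w \<bullet> w)\<close>, which forces \<open>w = 0\<close>.
\<close>

lemma symmetric_eigenvector_in_invariant_subspace:
  fixes A :: "real ^ 'n::finite ^ 'n"
  assumes sym: "transpose A = A" and V: "subspace V"
    and inv: "\<And>v. v \<in> V \<Longrightarrow> A *v v \<in> V"
    and y: "y \<in> V" "y \<noteq> 0"
  obtains u where "u \<in> V" "norm u = 1" "A *v u = (u \<bullet> (A *v u)) *\<^sub>R u"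
proof -
  have "compact (sphere 0 1 \<inter> V)"
    by (intro compact_Int_closed closed_subspace V) auto
  moreover have "y /\<^sub>R norm y \<in> sphere 0 1 \<inter> V"
    using y V by (auto simp: subspace_scale)
  moreover have "continuous_on (sphere 0 1 \<inter> V) (\<lambda>v. v \<bullet> (A *v v))"
    by (intro continuous_intros matrix_vector_mult_linear_continuous_on)
  ultimately have "\<exists>u \<in> sphere 0 1 \<inter> V. \<forall>v \<in> sphere 0 1 \<inter> V. v \<bullet> (A *v v) \<le> u \<bullet> (A *v u)"
    by (intro continuous_attains_sup) (assumption | blast)+
  then obtain u where u: "u \<in> V" "norm u = 1"
    and max: "\<And>v. v \<in> V \<Longrightarrow> norm v = 1 \<Longrightarrow> v \<bullet> (A *v v) \<le> u \<bullet> (A *v u)"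
    by auto
  define l where "l = u \<bullet> (A *v u)"
  have q_nonneg: "v \<bullet> (A *v v) \<le> l * (v \<bullet> v)" if v: "v \<in> V" for v
  proof (cases "v = 0")
    case False
    have "(v /\<^sub>R norm v) \<bullet> (A *v (v /\<^sub>R norm v)) \<le> l"
      unfolding l_def by (rule max) (use v V False in \<open>auto simp: subspace_scale\<close>)
    then have "(v \<bullet> (A *v v)) / (norm v)\<^sup>2 \<le> l"
      by (simp add: matrix_vector_mult_scaleR power2_eq_square divide_inverse mult_ac)
    then show ?thesis
      using False by (simp add: divide_le_eq power2_norm_eq_inner)
  qed simp
  define w where "w = A *v u - l *\<^sub>R u"
  have wV: "w \<in> V"
    unfolding w_def by (intro subspace_diff subspace_scale V inv u)
  define q where "q = l * (w \<bullet> w) - w \<bullet> (A *v w)"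
  have q0: "0 \<le> q" using q_nonneg[OF wV] by (simp add: q_def)
  \<comment> \<open>A step small enough for the first-order term to outweigh \<open>t\<^sup>2 q\<close>; the added 1 covers \<open>q = 0\<close>.\<close>
  define t where "t = (w \<bullet> w) / (q + 1)"
  have uu: "u \<bullet> u = 1" using u by (simp add: norm_eq_1)
  have cross: "w \<bullet> (A *v u) = w \<bullet> w + l * (u \<bullet> w)"
    by (simp add: w_def inner_simps inner_commute algebra_simps)
  have cross': "u \<bullet> (A *v w) = w \<bullet> (A *v u)"
    using symmetric_inner_mult[OF sym] by (metis inner_commute)
  have "u + t *\<^sub>R w \<in> V" by (intro subspace_add subspace_scale V u wV)
  from q_nonneg[OF this] have "2 * t * (w \<bullet> w) \<le> t * t * q"
    by (simp add: matrix_vector_right_distrib matrix_vector_mult_scaleR inner_simps cross cross'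
        uu q_def inner_commute[of w u] l_def[symmetric] algebra_simps)
  have "w \<bullet> w = 0"
  proof (rule ccontr)
    assume "w \<bullet> w \<noteq> 0"
    then have pos: "0 < w \<bullet> w" by simp
    then have tpos: "0 < t" using q0 by (simp add: t_def)
    have "t * (2 * (w \<bullet> w)) \<le> t * (t * q)"
      using \<open>2 * t * (w \<bullet> w) \<le> t * t * q\<close> by (simp add: mult_ac)
    then have "2 * (w \<bullet> w) \<le> t * q" using tpos by simp
    moreover have "t * (q + 1) = w \<bullet> w" using q0 by (simp add: t_def)
    ultimately show False using tpos pos by (simp add: algebra_simps)
  qed
  then have "A *v u = l *\<^sub>R u" by (simp add: w_def)
  then show ?thesis using that u by (simp add: l_def)
qed

text \<open>
  A largest orthonormal set of eigenvectors spans: its orthogonal complement is invariant under a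
  symmetric matrix, so if it were nonzero it would contain a further eigenvector.
\<close>

lemma symmetric_orthonormal_eigenbasis:
  fixes A :: "real ^ 'n::finite ^ 'n"
  assumes sym: "transpose A = A"
  obtains E where "finite E" "pairwise orthogonal E" "\<And>e. e \<in> E \<Longrightarrow> norm e = 1"
    "\<And>e. e \<in> E \<Longrightarrow> A *v e = (e \<bullet> (A *v e)) *\<^sub>R e" "span E = UNIV"
proof -
  define P where "P E \<longleftrightarrow> pairwise orthogonal E \<and>
      (\<forall>e\<in>E. norm e = 1 \<and> A *v e = (e \<bullet> (A *v e)) *\<^sub>R e)" for E :: "(real ^ 'n) set"
  have bound: "finite E \<and> card E \<le> DIM(real ^ 'n)" if "P E" for E
  proof -
    have "pairwise orthogonal E" "0 \<notin> E" using that unfolding P_def by force+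
    then have "independent E" by (rule pairwise_orthogonal_independent)
    then show ?thesis by (rule independent_bound)
  qed
  have "P {}" by (simp add: P_def)
  then obtain E where E: "P E" and max: "\<And>F. P F \<Longrightarrow> card F \<le> card E"
    using ex_has_greatest_nat[of P "{}" card "Suc (DIM(real ^ 'n))"] bound le_imp_less_Suc by blast
  have "span E = UNIV"
  proof (rule ccontr)
    assume "span E \<noteq> UNIV"
    then obtain y where y: "y \<noteq> 0" "\<And>x. x \<in> span E \<Longrightarrow> orthogonal y x"
      using orthogonal_to_subspace_exists_gen[of E UNIV]
      by (metis UNIV_I psubsetI span_UNIV subset_UNIV)
    define V where "V = {y. \<forall>x\<in>E. orthogonal x y}"
    have V: "subspace V" unfolding V_def by (rule subspace_orthogonal_to_vectors)
    have yV: "y \<in> V" using y(2) by (auto simp: V_def orthogonal_commute span_base)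
    have inv: "A *v v \<in> V" if "v \<in> V" for v
      unfolding V_def orthogonal_def
    proof (intro CollectI ballI)
      fix e assume e: "e \<in> E"
      have "e \<bullet> (A *v v) = ((e \<bullet> (A *v e)) *\<^sub>R e) \<bullet> v"
        using E e by (metis P_def symmetric_inner_mult[OF sym])
      also have "\<dots> = 0" using that e by (simp add: V_def orthogonal_def)
      finally show "e \<bullet> (A *v v) = 0" .
    qed
    obtain u where u: "u \<in> V" "norm u = 1" "A *v u = (u \<bullet> (A *v u)) *\<^sub>R u"
      using symmetric_eigenvector_in_invariant_subspace[OF sym V inv yV y(1)] by blast
    have "u \<notin> E" using u by (auto simp: V_def orthogonal_def)
    moreover have "P (insert u E)"
      using E u unfolding P_def by (auto simp: pairwise_insert V_def orthogonal_commute)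
    ultimately show False using max[of "insert u E"] bound[OF E] by simp
  qed
  then show ?thesis using that E bound unfolding P_def by blast
qed

section \<open>The positive semidefinite square root and its determinant\<close>

lemma matrix_eq_on_spanning:
  fixes A B :: "real ^ 'n::finite ^ 'm::finite"
  assumes "span E = UNIV" and "\<And>e. e \<in> E \<Longrightarrow> A *v e = B *v e"
  shows "A = B"
  unfolding matrix_eq
  using linear_eq_on_span[of "(*v) A" "(*v) B" E] assms by auto

lemma sym_psd_sqrt_exists:
  fixes A :: "real ^ 'n::finite ^ 'n"
  assumes A: "sym_psd A"
  obtains B where "sym_psd B" "B ** B = A"
proof -
  have sym: "transpose A = A" and psd: "\<And>v. 0 \<le> v \<bullet> (A *v v)"
    using A by (auto simp: sym_psd_def)
  obtain E where E: "finite E" "pairwise orthogonal E" "\<And>e. e \<in> E \<Longrightarrow> norm e = 1"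
    "\<And>e. e \<in> E \<Longrightarrow> A *v e = (e \<bullet> (A *v e)) *\<^sub>R e" "span E = UNIV"
    using symmetric_orthonormal_eigenbasis[OF sym] by blast
  define r where "r e = sqrt (e \<bullet> (A *v e))" for e
  define f where "f v = (\<Sum>e\<in>E. (r e * (e \<bullet> v)) *\<^sub>R e)" for v
  define B where "B = matrix f"
  have "linear f"
    unfolding f_def
    by (intro linearI) (simp_all add: inner_simps algebra_simps sum.distrib scaleR_sum_right)
  then have B: "B *v v = f v" for v by (simp add: B_def matrix_works)
  have form: "x \<bullet> (B *v y) = (\<Sum>e\<in>E. r e * (e \<bullet> x) * (e \<bullet> y))" for x y
    by (simp add: B f_def inner_sum_right inner_commute mult_ac)
  have "x \<bullet> (transpose B *v y) = x \<bullet> (B *v y)" for x y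
  proof -
    have "x \<bullet> (transpose B *v y) = y \<bullet> (B *v x)"
      by (simp add: dot_lmul_matrix inner_commute[of x])
    then show ?thesis by (simp add: form mult_ac)
  qed
  then have "transpose B *v y = B *v y" for y by (metis vector_eq_ldot)
  then have "transpose B = B" by (simp only: matrix_eq simp_thms)
  moreover have "0 \<le> v \<bullet> (B *v v)" for v
    unfolding form by (intro sum_nonneg) (simp add: r_def psd mult.assoc)
  ultimately have "sym_psd B" by (simp add: sym_psd_def)
  have Be: "B *v e = r e *\<^sub>R e" if e: "e \<in> E" for e
  proof -
    have "f e = (\<Sum>d\<in>E. if d = e then r e *\<^sub>R e else 0)"
      unfolding f_def
    proof (rule sum.cong)
      fix d assume d: "d \<in> E"
      show "(r d * (d \<bullet> e)) *\<^sub>R d = (if d = e then r e *\<^sub>R e else 0)"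
      proof (cases "d = e")
        case True
        then show ?thesis using E(3)[OF e] by (simp add: norm_eq_1)
      next
        case False
        then have "d \<bullet> e = 0" using E(2) d e by (auto simp: pairwise_def orthogonal_def)
        then show ?thesis using False by simp
      qed
    qed simp
    then show ?thesis using E(1) e by (simp add: B)
  qed
  have "B ** B = A"
  proof (rule matrix_eq_on_spanning[OF E(5)])
    fix e assume e: "e \<in> E"
    have "(B ** B) *v e = (r e * r e) *\<^sub>R e"
      by (simp add: matrix_vector_mul_assoc[symmetric] Be[OF e] matrix_vector_mult_scaleR)
    also have "r e * r e = e \<bullet> (A *v e)" by (simp add: r_def psd)
    finally show "(B ** B) *v e = A *v e" using E(4)[OF e] by simp
  qed
  then show ?thesis using that \<open>sym_psd B\<close> by blast
qed

text \<open>
  The matrix to diagonalise is \<open>B - C\<close>. For a unit eigenvector \<open>e\<close> with eigenvalue \<open>m\<close>, comparing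
  \<open>B e \<bullet> B e\<close> with \<open>C e \<bullet> C e\<close> yields \<open>m (e \<bullet> B e + e \<bullet> C e) = 0\<close>; if the second factor
  vanishes, semidefiniteness makes both of its terms zero, and their difference is \<open>m\<close>.
\<close>

lemma sym_psd_sqrt_unique:
  fixes B C :: "real ^ 'n::finite ^ 'n"
  assumes B: "sym_psd B" and C: "sym_psd C" and eq: "B ** B = C ** C"
  shows "B = C"
proof -
  have symB: "transpose B = B" and symC: "transpose C = C"
    and psdB: "\<And>v. 0 \<le> v \<bullet> (B *v v)" and psdC: "\<And>v. 0 \<le> v \<bullet> (C *v v)"
    using B C by (auto simp: sym_psd_def)
  have symD: "transpose (B - C) = B - C"
    using symB symC by (simp add: transpose_def vec_eq_iff)
  obtain E where E: "\<And>e. e \<in> E \<Longrightarrow> (B - C) *v e = (e \<bullet> ((B - C) *v e)) *\<^sub>R e" "span E = UNIV"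
    by (rule symmetric_orthonormal_eigenbasis[OF symD]) (rule that)
  show ?thesis
  proof (rule matrix_eq_on_spanning[OF E(2)])
    fix e assume e: "e \<in> E"
    define m where "m = e \<bullet> ((B - C) *v e)"
    have De: "B *v e - C *v e = m *\<^sub>R e"
      using E(1)[OF e] by (simp add: m_def matrix_vector_mult_diff_rdistrib)
    then have Be: "B *v e = C *v e + m *\<^sub>R e" by (simp add: algebra_simps)
    have "(B *v e) \<bullet> (B *v e) = e \<bullet> ((B ** B) *v e)"
      by (simp add: matrix_vector_mul_assoc[symmetric] symmetric_inner_mult[OF symB])
    also have "\<dots> = (C *v e) \<bullet> (C *v e)"
      by (simp add: eq) (simp add: matrix_vector_mul_assoc[symmetric] symmetric_inner_mult[OF symC])
    finally have "0 = (B *v e - C *v e) \<bullet> (B *v e + C *v e)"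
      by (simp add: inner_simps inner_commute)
    also have "\<dots> = m * (e \<bullet> (B *v e) + e \<bullet> (C *v e))"
      unfolding De by (simp add: inner_simps distrib_left)
    finally have "m = 0 \<or> e \<bullet> (B *v e) + e \<bullet> (C *v e) = 0" by simp
    then have "m = 0"
    proof
      assume "e \<bullet> (B *v e) + e \<bullet> (C *v e) = 0"
      then have "e \<bullet> (B *v e) = 0" "e \<bullet> (C *v e) = 0" using psdB[of e] psdC[of e] by linarith+
      then show "m = 0" by (simp add: m_def matrix_vector_mult_diff_rdistrib inner_simps)
    qed
    then show "B *v e = C *v e" using Be by simp
  qed
qed

text \<open>
  Taking a root once more exhibits the determinant as a square.
\<close>

lemma det_sym_psd_nonneg:
  assumes "sym_psd A"
  shows "0 \<le> det A"
proof -
  obtain B where "B ** B = A" using sym_psd_sqrt_exists[OF assms] by blast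
  then show ?thesis by (auto simp: det_mul)
qed

lemma det_psd_sqrt:
  assumes A: "sym_psd A"
  shows "det (psd_sqrt A) = sqrt (det A)"
proof -
  obtain B where B: "sym_psd B" "B ** B = A"
    using sym_psd_sqrt_exists[OF A] by blast
  then have "psd_sqrt A = B"
    unfolding psd_sqrt_def using sym_psd_sqrt_unique by (intro the_equality) auto
  moreover have "det A = (det B)\<^sup>2" using B(2) det_mul by (metis power2_eq_square)
  ultimately show ?thesis using det_sym_psd_nonneg[OF B(1)] by simp
qed

lemma inner_gram:
  fixes S :: "real ^ 'p::finite ^ 'n::finite"
  shows "v \<bullet> ((S ** transpose S) *v v) = (transpose S *v v) \<bullet> (transpose S *v v)"
  by (metis dot_lmul_matrix matrix_vector_mul_assoc transpose_matrix_vector)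

lemma sym_psd_gram: "sym_psd (S ** transpose S)"
  by (simp add: sym_psd_def matrix_transpose_mul inner_gram del: transpose_matrix_vector)

lemma full_row_rank_imp_det_gram_pos:
  fixes S :: "real ^ 'p::finite ^ 'n::finite"
  assumes "full_row_rank S"
  shows "0 < det (S ** transpose S)"
proof -
  have "inj ((*v) (transpose S))"
    using assms by (simp add: full_row_rank_def full_rank_injective[symmetric] rank_transpose del: transpose_matrix_vector)
  moreover have "transpose S *v v = 0" if "(S ** transpose S) *v v = 0" for v
    using that inner_gram[of v S] by (simp del: transpose_matrix_vector)
  ultimately have "v = 0" if "(S ** transpose S) *v v = 0" for v
    using that by (metis inj_eq matrix_vector_mult_0_right)
  then have "inj ((*v) (S ** transpose S))"
    by (simp add: linear_injective_0)
  then have "det (S ** transpose S) \<noteq> 0"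
    by (simp add: inj_matrix_vector_mult invertible_det_nz[symmetric] invertible_left_inverse matrix_left_invertible_injective)
  then show ?thesis using det_sym_psd_nonneg[OF sym_psd_gram, of S] by simp
qed

section \<open>The derivative of the determinant\<close>

text \<open>
  In the Leibniz expansion a permutation other than the identity moves at least two indices, so
  its product has at least two factors vanishing at \<open>t0\<close> and contributes nothing to first order.
\<close>

lemma has_real_derivative_det_at_identity:
  fixes M :: "real \<Rightarrow> real ^ 'n::finite ^ 'n"
  assumes M: "\<And>k l. ((\<lambda>t. M t $ k $ l) has_real_derivative M' $ k $ l) (at t0)"
    and one: "M t0 = mat 1"
  shows "((\<lambda>t. det (M t)) has_real_derivative trace M') (at t0)"
proof -
  let ?d = "\<lambda>p. \<Sum>i\<in>UNIV. M' $ i $ p i * (\<Prod>j\<in>UNIV - {i}. M t0 $ j $ p j)"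
  have "((\<lambda>t. det (M t)) has_real_derivative
      (\<Sum>p | p permutes (UNIV :: 'n set). of_int (sign p) * ?d p)) (at t0)"
    unfolding det_def
    by (intro DERIV_sum DERIV_cmult has_field_derivative_prod M)
  also have "(\<Sum>p | p permutes (UNIV :: 'n set). of_int (sign p) * ?d p)
      = (\<Sum>p | p permutes (UNIV :: 'n set). if p = id then trace M' else 0)"
  proof (rule sum.cong)
    fix p :: "'n \<Rightarrow> 'n" assume "p \<in> {p. p permutes UNIV}"
    then have p: "p permutes UNIV" by simp
    show "of_int (sign p) * ?d p = (if p = id then trace M' else 0)"
    proof (cases "p = id")
      case True
      then show ?thesis by (simp add: one mat_def trace_def)
    next
      case False
      have "(\<Prod>j\<in>UNIV - {i}. M t0 $ j $ p j) = 0" for i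
      proof -
        obtain k where k: "p k \<noteq> k" using False by (auto simp: fun_eq_iff)
        have "p (p k) \<noteq> p k" using k permutes_inj[OF p] by (simp add: inj_eq)
        then obtain j where "j \<noteq> i" "p j \<noteq> j" using k by (cases "k = i") auto
        then show ?thesis by (auto simp: one mat_def intro!: bexI[of _ j])
      qed
      then have "?d p = 0" by (simp del: prod_zero_iff)
      then show ?thesis using False by simp
    qed
  qed simp
  also have "\<dots> = trace M'" by (simp add: finite_permutations permutes_id)
  finally show ?thesis .
qed

text \<open>
  Jacobi's formula, obtained from the case \<open>M t0 = mat 1\<close> by multiplying with the constant
  inverse of \<open>M t0\<close>.
\<close>

lemma has_real_derivative_det:
  fixes M :: "real \<Rightarrow> real ^ 'n::finite ^ 'n"
  assumes M: "\<And>k l. ((\<lambda>t. M t $ k $ l) has_real_derivative M' $ k $ l) (at t0)"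
    and inv: "invertible (M t0)"
  shows "((\<lambda>t. det (M t)) has_real_derivative
      det (M t0) * trace (matrix_inv (M t0) ** M')) (at t0)"
proof -
  let ?R = "matrix_inv (M t0)"
  have R: "?R ** M t0 = mat 1" "M t0 ** ?R = mat 1"
    using inv someI_ex[of "\<lambda>R. M t0 ** R = mat 1 \<and> R ** M t0 = mat 1"]
    unfolding invertible_def matrix_inv_def by auto
  have "((\<lambda>t. det (?R ** M t)) has_real_derivative trace (?R ** M')) (at t0)"
    by (rule has_real_derivative_det_at_identity)
      (auto simp: matrix_matrix_mult_def R[unfolded matrix_matrix_mult_def] intro!: DERIV_sum DERIV_cmult M)
  then have "((\<lambda>t. det (M t0) * det (?R ** M t)) has_real_derivative
      det (M t0) * trace (?R ** M')) (at t0)"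
    by (rule DERIV_cmult)
  moreover have "det (M t0) * det (?R ** M t) = det (M t)" for t
    by (metis R(2) det_mul matrix_mul_assoc matrix_mul_lid)
  ultimately show ?thesis by simp
qed

text \<open>
  With \<open>E\<close> the matrix unit at \<open>(i, j)\<close>, the Gram matrix moves in the direction
  \<open>E S\<^sup>T + S E\<^sup>T\<close>. The inverse \<open>R\<close> of a Gram matrix is symmetric, so \<open>R S E\<^sup>T\<close> is the transpose of
  \<open>E S\<^sup>T R\<close> and both summands contribute the same trace to Jacobi's formula; hence the factor 2.
\<close>

lemma has_real_derivative_det_gram_entry:
  fixes S :: "real \<Rightarrow> real ^ 'p::finite ^ 'n::finite"
  assumes S: "\<And>k m. ((\<lambda>t. S t $ k $ m) has_real_derivative (if k = i \<and> m = j then 1 else 0)) (at t0)"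
    and det: "det (S t0 ** transpose (S t0)) \<noteq> 0"
  shows "((\<lambda>t. det (S t ** transpose (S t))) has_real_derivative
      2 * det (S t0 ** transpose (S t0)) * pseudo_inverse (S t0) $ j $ i) (at t0)"
proof -
  define E :: "real ^ 'p ^ 'n" where "E = (\<chi> k m. if k = i \<and> m = j then 1 else 0)"
  define G where "G = S t0 ** transpose (S t0)"
  define R where "R = matrix_inv G"
  define M' where "M' = E ** transpose (S t0) + S t0 ** transpose E"
  have inv: "invertible G" using det by (simp add: G_def invertible_det_nz)
  then have R: "R ** G = mat 1" "G ** R = mat 1"
    using someI_ex[of "\<lambda>R. G ** R = mat 1 \<and> R ** G = mat 1"]
    unfolding invertible_def matrix_inv_def R_def by auto
  have symG: "transpose G = G" by (simp add: G_def matrix_transpose_mul)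
  have symR: "transpose R = R"
    by (metis R symG matrix_mul_assoc matrix_mul_lid matrix_mul_rid matrix_transpose_mul transpose_mat)
  have entry: "((\<lambda>t. (S t ** transpose (S t)) $ k $ l) has_real_derivative M' $ k $ l) (at t0)" for k l
  proof -
    have S': "((\<lambda>t. S t $ k $ m) has_real_derivative E $ k $ m) (at t0)" for k m
      using S[of k m] by (simp add: E_def)
    have "((\<lambda>t. \<Sum>m\<in>UNIV. S t $ k $ m * S t $ l $ m) has_real_derivative
        (\<Sum>m\<in>UNIV. E $ k $ m * S t0 $ l $ m + E $ l $ m * S t0 $ k $ m)) (at t0)"
      by (intro DERIV_sum DERIV_mult S')
    also have "(\<Sum>m\<in>UNIV. E $ k $ m * S t0 $ l $ m + E $ l $ m * S t0 $ k $ m) = M' $ k $ l"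
      by (simp add: M'_def matrix_matrix_mult_def transpose_def sum.distrib mult.commute)
    finally show ?thesis by (simp add: matrix_matrix_mult_def transpose_def)
  qed
  have tr: "trace (R ** (E ** transpose (S t0))) = pseudo_inverse (S t0) $ j $ i"
  proof -
    have "trace (R ** (E ** transpose (S t0))) = trace (E ** (transpose (S t0) ** R))"
      by (metis matrix_mul_assoc trace_mul_sym)
    also have "\<dots> = trace (E ** pseudo_inverse (S t0))"
      by (simp add: pseudo_inverse_def R_def G_def)
    also have "\<dots> = (\<Sum>k\<in>UNIV. \<Sum>m\<in>UNIV. if k = i \<and> m = j then pseudo_inverse (S t0) $ j $ i else 0)"
      unfolding trace_def matrix_matrix_mult_def E_def by (auto intro!: sum.cong)
    also have "\<dots> = (\<Sum>k\<in>UNIV. if k = i then pseudo_inverse (S t0) $ j $ i else 0)"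
      by (intro sum.cong) auto
    finally show ?thesis by simp
  qed
  have tr_transpose: "trace (transpose X) = trace X" for X :: "real ^ 'n ^ 'n"
    by (simp add: trace_def transpose_def)
  have "trace (R ** (S t0 ** transpose E)) = trace (transpose (R ** (S t0 ** transpose E)))"
    by (simp add: tr_transpose)
  also have "\<dots> = trace ((E ** transpose (S t0)) ** R)"
    by (simp add: matrix_transpose_mul symR)
  also have "\<dots> = trace (R ** (E ** transpose (S t0)))"
    by (rule trace_mul_sym)
  finally have "trace (R ** M') = 2 * pseudo_inverse (S t0) $ j $ i"
    by (simp add: M'_def matrix_add_ldistrib trace_add tr)
  then show ?thesis
    using has_real_derivative_det[of "\<lambda>t. S t ** transpose (S t)" M' t0, OF entry] inv
    by (simp add: G_def R_def mult_ac)
qed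

section \<open>Critical completions and zeros of the pseudo-inverse\<close>

theorem mainTheorem2:
  fixes I :: "('n::finite \<times> 'p::finite) set"
    and \<sigma> xbar :: "'n \<times> 'p \<Rightarrow> real"
  assumes "CARD('n) \<le> CARD('p)"
  shows "(full_row_rank (partial_matrix I \<sigma> xbar) \<and>
          (\<forall>(i, j) \<in> I\<inverse>. pseudo_inverse (partial_matrix I \<sigma> xbar) $ i $ j = 0))
     \<longleftrightarrow>
         (full_row_rank (partial_matrix I \<sigma> xbar) \<and>
          critical_point I
            (\<lambda>x. det (psd_sqrt (partial_matrix I \<sigma> x ** transpose (partial_matrix I \<sigma> x)))) xbar)"
proof (rule conj_cong[OF refl])
  define S where "S = partial_matrix I \<sigma> xbar"
  define d where "d = det (S ** transpose S)"
  let ?f = "\<lambda>x. det (psd_sqrt (partial_matrix I \<sigma> x ** transpose (partial_matrix I \<sigma> x)))"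
  assume "full_row_rank (partial_matrix I \<sigma> xbar)"
  then have d: "0 < d" unfolding d_def S_def by (rule full_row_rank_imp_det_gram_pos)
  have deriv: "((\<lambda>t. ?f (xbar((i, j) := t))) has_real_derivative
      sqrt d * pseudo_inverse S $ j $ i) (at (xbar (i, j)))" if ij: "(i, j) \<in> I" for i j
  proof -
    let ?S = "\<lambda>t. partial_matrix I \<sigma> (xbar((i, j) := t))"
    have S0: "?S (xbar (i, j)) = S" by (simp add: S_def)
    have entry: "((\<lambda>t. ?S t $ k $ m) has_real_derivative (if k = i \<and> m = j then 1 else 0))
        (at (xbar (i, j)))" for k m
    proof (cases "k = i \<and> m = j")
      case True
      then show ?thesis using ij by (simp add: partial_matrix_def)
    next
      case False
      then have "(\<lambda>t. ?S t $ k $ m) = (\<lambda>t. S $ k $ m)"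
        by (auto simp: partial_matrix_def S_def fun_eq_iff)
      then show ?thesis using False by (simp only: DERIV_const if_False)
    qed
    have "((\<lambda>t. det (?S t ** transpose (?S t))) has_real_derivative
        2 * d * pseudo_inverse S $ j $ i) (at (xbar (i, j)))"
      using has_real_derivative_det_gram_entry[of ?S i j "xbar (i, j)", OF entry] d
      unfolding S0 d_def by simp
    moreover have "(sqrt has_real_derivative inverse (sqrt d) / 2)
        (at (det (?S (xbar (i, j)) ** transpose (?S (xbar (i, j))))))"
      unfolding S0 d_def[symmetric] using d by (rule DERIV_real_sqrt)
    ultimately have "((\<lambda>t. sqrt (det (?S t ** transpose (?S t)))) has_real_derivative
        inverse (sqrt d) / 2 * (2 * d * pseudo_inverse S $ j $ i)) (at (xbar (i, j)))"
      by (intro DERIV_chain2[where f = sqrt])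
    moreover have "inverse (sqrt d) / 2 * (2 * d * pseudo_inverse S $ j $ i)
        = sqrt d * pseudo_inverse S $ j $ i"
      using d by (simp add: field_simps)
    ultimately show ?thesis by (simp only: det_psd_sqrt[OF sym_psd_gram])
  qed
  have "((\<lambda>t. ?f (xbar((i, j) := t))) has_real_derivative 0) (at (xbar (i, j)))
      \<longleftrightarrow> pseudo_inverse S $ j $ i = 0" if ij: "(i, j) \<in> I" for i j
    using deriv[OF ij] DERIV_unique[OF deriv[OF ij]] d by fastforce
  then show "(\<forall>(i, j) \<in> I\<inverse>. pseudo_inverse (partial_matrix I \<sigma> xbar) $ i $ j = 0)
      \<longleftrightarrow> critical_point I ?f xbar"
    unfolding critical_point_def S_def by fastforce
qed

end
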